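(* Every DMV-algebra is the subdirect product of linear (i.e. totally ordered) DMV-algebras.
   Context: An MV-algebra is a structure $(A,\oplus,\neg,0,1)$ satisfying: $x\oplus(y\oplus z)=(x\oplus y)\oplus z$; $x\oplus y=y\oplus x$; $x\oplus 0=x$; $x\oplus 1=1$; $\neg 0=1$; $\neg 1=0$; $\neg(\neg x\oplus y)\oplus y=\neg(\neg y\oplus x)\oplus x$. One sets $x\odot y=\neg(\neg x\oplus\neg y)$, and $x\le y$ iff $\neg x\oplus y=1$ (a partial order). For $x\in A$ and $n\ge 0$, $n.x\in A$ is defined by $0.x=0$ and $n.x=(n-1).x\oplus x$. A DMV-algebra is a structure $A=(A,\oplus,\neg,\{\delta_n\}_{n\ge 1},0,1)$, each $\delta_n$ being a unary operation, such that $A^*=(A,\oplus,\neg,0,1)$ is an MV-algebra and for every $x\in A$ and every integer $n\ge 1$: (D1n) $n.\delta_n x=x$; (D2n) $\delta_n x\odot (n-1).\delta_n x=0$. It is linear if the order $\le$ is total. Subdirect product is meant in the usual sense of universal algebra, for the signature $\{\oplus,\neg,0,1\}\cup\{\delta_n\}_{n\ge 1}$: $A$ is, up to isomorphism, a subalgebra of a direct product that projects onto every factor. *)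

theory Defs
  imports "HOL-Algebra.Congruence" "HOL-Library.FuncSet"
begin

section \<open>MV-algebras\<close>

record 'a mv_struct = "'a partial_object" +
  mv_plus :: "'a \<Rightarrow> 'a \<Rightarrow> 'a" (infixl "\<oplus>\<index>" 65)
  mv_neg :: "'a \<Rightarrow> 'a" ("\<sim>\<index> _" [81] 80)
  mv_zero :: 'a ("\<zero>\<index>")
  mv_one :: 'a ("\<one>\<index>")

definition mv_times :: "('a, 'm) mv_struct_scheme \<Rightarrow> 'a \<Rightarrow> 'a \<Rightarrow> 'a" (infixl "\<odot>\<index>" 70)
  where "x \<odot>\<^bsub>A\<^esub> y = \<sim>\<^bsub>A\<^esub> (\<sim>\<^bsub>A\<^esub> x \<oplus>\<^bsub>A\<^esub> \<sim>\<^bsub>A\<^esub> y)"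

definition mv_le :: "('a, 'm) mv_struct_scheme \<Rightarrow> 'a \<Rightarrow> 'a \<Rightarrow> bool"
  where "mv_le A x y \<longleftrightarrow> \<sim>\<^bsub>A\<^esub> x \<oplus>\<^bsub>A\<^esub> y = \<one>\<^bsub>A\<^esub>"

primrec mv_multiple :: "('a, 'm) mv_struct_scheme \<Rightarrow> nat \<Rightarrow> 'a \<Rightarrow> 'a"
  where
    "mv_multiple A 0 x = \<zero>\<^bsub>A\<^esub>"
  | "mv_multiple A (Suc n) x = mv_multiple A n x \<oplus>\<^bsub>A\<^esub> x"

locale mv_algebra =
  fixes A :: "('a, 'm) mv_struct_scheme" (structure)
  assumes plus_closed: "\<lbrakk>x \<in> carrier A; y \<in> carrier A\<rbrakk> \<Longrightarrow> x \<oplus> y \<in> carrier A"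
    and neg_closed: "x \<in> carrier A \<Longrightarrow> \<sim> x \<in> carrier A"
    and zero_closed: "\<zero> \<in> carrier A"
    and one_closed: "\<one> \<in> carrier A"
    and plus_assoc: "\<lbrakk>x \<in> carrier A; y \<in> carrier A; z \<in> carrier A\<rbrakk>
      \<Longrightarrow> x \<oplus> (y \<oplus> z) = (x \<oplus> y) \<oplus> z"
    and plus_comm: "\<lbrakk>x \<in> carrier A; y \<in> carrier A\<rbrakk> \<Longrightarrow> x \<oplus> y = y \<oplus> x"
    and plus_zero: "x \<in> carrier A \<Longrightarrow> x \<oplus> \<zero> = x"
    and plus_one: "x \<in> carrier A \<Longrightarrow> x \<oplus> \<one> = \<one>"
    and neg_zero: "\<sim> \<zero> = \<one>"
    and neg_one: "\<sim> \<one> = \<zero>"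
    and lukasiewicz: "\<lbrakk>x \<in> carrier A; y \<in> carrier A\<rbrakk>
      \<Longrightarrow> \<sim> (\<sim> x \<oplus> y) \<oplus> y = \<sim> (\<sim> y \<oplus> x) \<oplus> x"


section \<open>DMV-algebras\<close>

text \<open>The operations \<open>\<delta>\<^sub>n\<close> belong to the signature only for \<open>n \<ge> 1\<close>; the value of the
  field at index 0 is junk and is never constrained below.\<close>

record 'a dmv_struct = "'a mv_struct" +
  dmv_delta :: "nat \<Rightarrow> 'a \<Rightarrow> 'a" ("\<delta>\<index>")

locale dmv_algebra = mv_algebra A
  for A :: "('a, 'm) dmv_struct_scheme" (structure) +
  assumes delta_closed: "\<lbrakk>n \<ge> 1; x \<in> carrier A\<rbrakk> \<Longrightarrow> \<delta> n x \<in> carrier A"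
    and D1: "\<lbrakk>n \<ge> 1; x \<in> carrier A\<rbrakk> \<Longrightarrow> mv_multiple A n (\<delta> n x) = x"
    and D2: "\<lbrakk>n \<ge> 1; x \<in> carrier A\<rbrakk>
      \<Longrightarrow> \<delta> n x \<odot> mv_multiple A (n - 1) (\<delta> n x) = \<zero>"

locale linear_dmv_algebra = dmv_algebra +
  assumes total: "\<lbrakk>x \<in> carrier A; y \<in> carrier A\<rbrakk> \<Longrightarrow> mv_le A x y \<or> mv_le A y x"


section \<open>Subdirect products\<close>

definition dmv_hom :: "'a dmv_struct \<Rightarrow> 'b dmv_struct \<Rightarrow> ('a \<Rightarrow> 'b) set"
  where "dmv_hom A B = {h \<in> carrier A \<rightarrow> carrier B.
    (\<forall>x \<in> carrier A. \<forall>y \<in> carrier A. h (x \<oplus>\<^bsub>A\<^esub> y) = h x \<oplus>\<^bsub>B\<^esub> h y) \<and>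
    (\<forall>x \<in> carrier A. h (\<sim>\<^bsub>A\<^esub> x) = \<sim>\<^bsub>B\<^esub> (h x)) \<and>
    h \<zero>\<^bsub>A\<^esub> = \<zero>\<^bsub>B\<^esub> \<and> h \<one>\<^bsub>A\<^esub> = \<one>\<^bsub>B\<^esub> \<and>
    (\<forall>n \<ge> 1. \<forall>x \<in> carrier A. h (\<delta>\<^bsub>A\<^esub> n x) = \<delta>\<^bsub>B\<^esub> n (h x))}"

definition dmv_iso :: "'a dmv_struct \<Rightarrow> 'b dmv_struct \<Rightarrow> ('a \<Rightarrow> 'b) set"
  where "dmv_iso A B = {h \<in> dmv_hom A B. bij_betw h (carrier A) (carrier B)}"

definition dmv_product :: "'i set \<Rightarrow> ('i \<Rightarrow> 'b dmv_struct) \<Rightarrow> ('i \<Rightarrow> 'b) dmv_struct"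
  where "dmv_product I B = \<lparr>
    carrier = (\<Pi>\<^sub>E i \<in> I. carrier (B i)),
    mv_plus = (\<lambda>f g. \<lambda>i \<in> I. f i \<oplus>\<^bsub>B i\<^esub> g i),
    mv_neg = (\<lambda>f. \<lambda>i \<in> I. \<sim>\<^bsub>B i\<^esub> (f i)),
    mv_zero = (\<lambda>i \<in> I. \<zero>\<^bsub>B i\<^esub>),
    mv_one = (\<lambda>i \<in> I. \<one>\<^bsub>B i\<^esub>),
    dmv_delta = (\<lambda>n f. \<lambda>i \<in> I. \<delta>\<^bsub>B i\<^esub> n (f i))\<rparr>"

definition dmv_subalgebra :: "'a set \<Rightarrow> 'a dmv_struct \<Rightarrow> bool"
  where "dmv_subalgebra S A \<longleftrightarrow> S \<subseteq> carrier A \<and>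
    (\<forall>x \<in> S. \<forall>y \<in> S. x \<oplus>\<^bsub>A\<^esub> y \<in> S) \<and>
    (\<forall>x \<in> S. \<sim>\<^bsub>A\<^esub> x \<in> S) \<and>
    \<zero>\<^bsub>A\<^esub> \<in> S \<and> \<one>\<^bsub>A\<^esub> \<in> S \<and>
    (\<forall>n \<ge> 1. \<forall>x \<in> S. \<delta>\<^bsub>A\<^esub> n x \<in> S)"

definition dmv_subdirect_product ::
  "'a dmv_struct \<Rightarrow> 'i set \<Rightarrow> ('i \<Rightarrow> 'b dmv_struct) \<Rightarrow> bool"
  where "dmv_subdirect_product A I B \<longleftrightarrow>
    (\<exists>S. dmv_subalgebra S (dmv_product I B) \<and>
         (\<forall>i \<in> I. (\<lambda>f. f i) ` S = carrier (B i)) \<and>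
         (\<exists>h. h \<in> dmv_iso A ((dmv_product I B)\<lparr>carrier := S\<rparr>)))"

end

theory Submission
  imports Defs
begin

text \<open>
  The proof follows Chang's representation theorem for MV-algebras.  Write
  \<open>x \<ominus> y = \<sim>(\<sim>x \<oplus> y)\<close> for truncated subtraction.  An ideal \<open>P\<close> induces the MV-congruence
  ``\<open>x \<ominus> y\<close> and \<open>y \<ominus> x\<close> both lie in \<open>P\<close>'', and the quotient is totally ordered exactly when \<open>P\<close>
  is prime, i.e. contains \<open>x \<ominus> y\<close> or \<open>y \<ominus> x\<close> for all \<open>x\<close> and \<open>y\<close>.  By Zorn's lemma every
  nonzero \<open>c\<close> is avoided by a prime ideal (\<open>prime_ideal_avoiding\<close>), so the quotients by all prime
  ideals together separate points.

  What is specific to DMV-algebras is that such a congruence also respects every \<open>\<delta>\<^sub>n\<close>, although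
  \<open>\<delta>\<^sub>n\<close> does not occur in the definition of an ideal.  The reason is that in a totally ordered
  MV-algebra an element \<open>y\<close> with \<open>y \<odot> (n - 1).y = 0\<close> is determined by \<open>n.y\<close>
  (\<open>divisor_unique\<close>): the condition says that the sum \<open>n.y\<close> is formed without truncation, and
  untruncated sums can be cancelled.  If \<open>x\<close> and \<open>y\<close> are congruent, the
  classes of \<open>\<delta>\<^sub>n x\<close> and \<open>\<delta>\<^sub>n y\<close> both satisfy this condition in the quotient and have
  the same \<open>n\<close>-th multiple, hence they agree.  So the same congruences give linear DMV-quotients,
  and the map sending an element to the family of its classes is the required embedding.
\<close>

section \<open>Arithmetic in MV-algebras\<close>

context mv_algebra
begin

abbreviation less_eq (infix "\<preceq>" 50) where "x \<preceq> y \<equiv> mv_le A x y"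

definition diff (infixl "\<ominus>" 65) where "x \<ominus> y = \<sim> (\<sim> x \<oplus> y)"

lemmas closed [simp] = plus_closed neg_closed zero_closed one_closed

lemma diff_closed [simp]: "x \<in> carrier A \<Longrightarrow> y \<in> carrier A \<Longrightarrow> x \<ominus> y \<in> carrier A"
  by (simp add: diff_def)

lemma multiple_closed [simp]: "x \<in> carrier A \<Longrightarrow> mv_multiple A n x \<in> carrier A"
  by (induction n) simp_all

lemma plus_left_comm:
  "x \<in> carrier A \<Longrightarrow> y \<in> carrier A \<Longrightarrow> z \<in> carrier A \<Longrightarrow> x \<oplus> (y \<oplus> z) = y \<oplus> (x \<oplus> z)"
  by (metis plus_assoc plus_comm)

lemmas plus_ac = plus_assoc[symmetric] plus_comm plus_left_comm

lemma zero_plus [simp]: "x \<in> carrier A \<Longrightarrow> \<zero> \<oplus> x = x"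
  by (metis plus_comm plus_zero zero_closed)

lemma one_plus [simp]: "x \<in> carrier A \<Longrightarrow> \<one> \<oplus> x = \<one>"
  by (metis plus_comm plus_one one_closed)

declare plus_zero [simp] plus_one [simp] neg_zero [simp] neg_one [simp]

lemma neg_neg [simp]: "x \<in> carrier A \<Longrightarrow> \<sim> (\<sim> x) = x"
  using lukasiewicz[of x "\<zero>"] by simp

lemma neg_eq_zero_iff: "x \<in> carrier A \<Longrightarrow> \<sim> x = \<zero> \<longleftrightarrow> x = \<one>"
  by (metis neg_neg neg_zero neg_one)

lemma neg_plus_self [simp]: "x \<in> carrier A \<Longrightarrow> \<sim> x \<oplus> x = \<one>"
  using lukasiewicz[of x "\<one>"] by simp

lemma le_refl [simp]: "x \<in> carrier A \<Longrightarrow> x \<preceq> x"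
  by (simp add: mv_le_def)

lemma zero_le [simp]: "x \<in> carrier A \<Longrightarrow> \<zero> \<preceq> x"
  by (simp add: mv_le_def)

lemma le_plus: "x \<in> carrier A \<Longrightarrow> y \<in> carrier A \<Longrightarrow> x \<preceq> x \<oplus> y"
  by (simp add: mv_le_def plus_assoc)

text \<open>Subtraction and addition are adjoint; most inequalities below are instances of this.\<close>

lemma diff_le_iff:
  assumes "x \<in> carrier A" "y \<in> carrier A" "z \<in> carrier A"
  shows "x \<ominus> y \<preceq> z \<longleftrightarrow> x \<preceq> y \<oplus> z"
  using assms by (simp add: mv_le_def diff_def plus_assoc)

text \<open>If \<open>x \<preceq> y\<close>, the axiom \<open>lukasiewicz\<close> collapses to this exact decomposition of \<open>y\<close>.\<close>

lemma le_imp_plus_diff: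
  assumes "x \<in> carrier A" "y \<in> carrier A" "x \<preceq> y"
  shows "x \<oplus> (y \<ominus> x) = y"
  using lukasiewicz[of x y] assms by (simp add: mv_le_def diff_def plus_comm)

lemma le_antisym:
  assumes "x \<in> carrier A" "y \<in> carrier A" "x \<preceq> y" "y \<preceq> x"
  shows "x = y"
  using lukasiewicz[of x y] assms by (simp add: mv_le_def)

lemma le_trans:
  assumes "x \<in> carrier A" "y \<in> carrier A" "z \<in> carrier A" "x \<preceq> y" "y \<preceq> z"
  shows "x \<preceq> z"
proof -
  have "x \<oplus> ((y \<ominus> x) \<oplus> (z \<ominus> y)) = (x \<oplus> (y \<ominus> x)) \<oplus> (z \<ominus> y)"
    using assms(1-3) by (simp add: plus_assoc)
  also have "\<dots> = z" using assms by (simp only: le_imp_plus_diff)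
  finally show ?thesis
    using le_plus[of x "(y \<ominus> x) \<oplus> (z \<ominus> y)"] assms(1-3) by simp
qed

lemma diff_eq_zero_iff:
  assumes "x \<in> carrier A" "y \<in> carrier A"
  shows "x \<ominus> y = \<zero> \<longleftrightarrow> x \<preceq> y"
  using assms by (simp add: diff_def mv_le_def neg_eq_zero_iff)

lemma le_zero_iff: "x \<in> carrier A \<Longrightarrow> x \<preceq> \<zero> \<longleftrightarrow> x = \<zero>"
  using le_antisym[of x "\<zero>"] by auto

lemma diff_self [simp]: "x \<in> carrier A \<Longrightarrow> x \<ominus> x = \<zero>"
  by (simp add: diff_def)

lemma diff_zero [simp]: "x \<in> carrier A \<Longrightarrow> x \<ominus> \<zero> = x"
  by (simp add: diff_def)

lemma diff_le: "x \<in> carrier A \<Longrightarrow> y \<in> carrier A \<Longrightarrow> x \<ominus> y \<preceq> x"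
  using le_plus[of x y] by (simp add: diff_le_iff plus_comm)

lemma le_plus_diff: "x \<in> carrier A \<Longrightarrow> y \<in> carrier A \<Longrightarrow> x \<preceq> y \<oplus> (x \<ominus> y)"
  using diff_le_iff[of x y "x \<ominus> y"] by simp

lemma plus_left_mono:
  assumes "x \<in> carrier A" "y \<in> carrier A" "z \<in> carrier A" "x \<preceq> y"
  shows "z \<oplus> x \<preceq> z \<oplus> y"
proof -
  have "z \<oplus> y = (z \<oplus> x) \<oplus> (y \<ominus> x)"
    using le_imp_plus_diff[of x y] assms by (simp add: plus_assoc[symmetric])
  then show ?thesis
    using le_plus[of "z \<oplus> x" "y \<ominus> x"] assms by simp
qed

lemma plus_mono:
  assumes "x \<in> carrier A" "y \<in> carrier A" "u \<in> carrier A" "v \<in> carrier A" "x \<preceq> y" "u \<preceq> v"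
  shows "x \<oplus> u \<preceq> y \<oplus> v"
proof -
  have "x \<oplus> u \<preceq> x \<oplus> v" using assms by (simp add: plus_left_mono)
  moreover have "x \<oplus> v \<preceq> y \<oplus> v" using assms plus_left_mono[of x y v] by (simp add: plus_comm)
  ultimately show ?thesis using assms le_trans[of "x \<oplus> u" "x \<oplus> v" "y \<oplus> v"] by simp
qed

lemma multiple_mono:
  assumes "x \<in> carrier A" "y \<in> carrier A" "x \<preceq> y"
  shows "mv_multiple A n x \<preceq> mv_multiple A n y"
  using assms by (induction n) (simp_all add: plus_mono)

lemma neg_diff_neg:
  assumes "x \<in> carrier A" "y \<in> carrier A"
  shows "\<sim> x \<ominus> \<sim> y = y \<ominus> x"
  using assms by (simp add: diff_def plus_comm)

text \<open>Subtracting from \<open>x\<close> whatever exceeds \<open>y\<close> gives the meet of \<open>x\<close> and \<open>y\<close>, a symmetric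
  expression by the axiom \<open>lukasiewicz\<close> applied to the complements.\<close>

lemma diff_diff_commute:
  assumes "x \<in> carrier A" "y \<in> carrier A"
  shows "x \<ominus> (x \<ominus> y) = y \<ominus> (y \<ominus> x)"
  using lukasiewicz[of "\<sim> y" "\<sim> x"] assms by (simp add: diff_def plus_comm)

lemma diff_diff_le: "x \<in> carrier A \<Longrightarrow> y \<in> carrier A \<Longrightarrow> x \<ominus> (x \<ominus> y) \<preceq> y"
  by (simp add: diff_diff_commute[of x y] diff_le)

lemma diff_antimono:
  assumes "x \<in> carrier A" "a \<in> carrier A" "b \<in> carrier A" "a \<preceq> b"
  shows "x \<ominus> b \<preceq> x \<ominus> a"
proof -
  have "x \<preceq> a \<oplus> (x \<ominus> a)" "a \<oplus> (x \<ominus> a) \<preceq> b \<oplus> (x \<ominus> a)"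
    using assms by (simp_all add: plus_mono le_plus_diff)
  then have "x \<preceq> b \<oplus> (x \<ominus> a)"
    by (rule le_trans[rotated 3]) (use assms in simp_all)
  then show ?thesis using assms by (simp add: diff_le_iff)
qed

lemma le_diff_diff:
  assumes "w \<in> carrier A" "x \<in> carrier A" "y \<in> carrier A" "w \<preceq> x" "w \<preceq> y"
  shows "w \<preceq> x \<ominus> (x \<ominus> y)"
proof -
  have "w = x \<ominus> (x \<ominus> w)"
    using assms diff_diff_commute[of x w] diff_eq_zero_iff[of w x] by simp
  moreover have "x \<ominus> (x \<ominus> w) \<preceq> x \<ominus> (x \<ominus> y)"
    using assms by (simp add: diff_antimono)
  ultimately show ?thesis by simp
qed

text \<open>A sum \<open>a \<oplus> b\<close> is untruncated when \<open>b \<preceq> \<sim> a\<close>.  Then \<open>b\<close> is recovered from it as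
  \<open>\<sim> a \<odot> (a \<oplus> b)\<close>, the meet of \<open>\<sim> a\<close> and \<open>b\<close>.\<close>

lemma plus_diff_cancel:
  assumes "a \<in> carrier A" "b \<in> carrier A" "b \<preceq> \<sim> a"
  shows "(a \<oplus> b) \<ominus> a = b"
proof -
  have "(a \<oplus> b) \<ominus> a = \<sim> a \<ominus> (\<sim> a \<ominus> b)"
    using assms by (simp add: diff_def plus_comm)
  also have "\<dots> = b \<ominus> (b \<ominus> \<sim> a)"
    using assms diff_diff_commute[of "\<sim> a" b] by simp
  also have "\<dots> = b"
    using assms diff_eq_zero_iff[of b "\<sim> a"] by simp
  finally show ?thesis .
qed

lemma times_eq_zero_iff:
  assumes "x \<in> carrier A" "y \<in> carrier A"
  shows "x \<odot> y = \<zero> \<longleftrightarrow> x \<preceq> \<sim> y"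
  using assms by (simp add: mv_times_def mv_le_def neg_eq_zero_iff)

text \<open>With \<open>m\<close> the meet of \<open>x\<close> and \<open>y\<close>, a common lower bound \<open>w\<close> of the two differences satisfies
  \<open>m \<oplus> w \<preceq> x\<close> and \<open>m \<oplus> w \<preceq> y\<close>, so \<open>m \<oplus> w = m\<close>, and cancelling \<open>m\<close> gives
  \<open>w = 0\<close>.\<close>

lemma prelinearity:
  assumes x: "x \<in> carrier A" and y: "y \<in> carrier A" and w: "w \<in> carrier A"
    and wx: "w \<preceq> x \<ominus> y" and wy: "w \<preceq> y \<ominus> x"
  shows "w = \<zero>"
proof -
  define m where "m = x \<ominus> (x \<ominus> y)"
  have m: "m \<in> carrier A" using x y by (simp add: m_def)
  have m': "m = y \<ominus> (y \<ominus> x)" using x y by (simp add: m_def diff_diff_commute)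
  have "m \<oplus> (x \<ominus> y) = x"
    using le_imp_plus_diff[of "x \<ominus> y" x] x y m by (simp add: m_def diff_le plus_comm)
  then have mwx: "m \<oplus> w \<preceq> x"
    using plus_left_mono[of w "x \<ominus> y" m] x y m w wx by simp
  have "m \<oplus> (y \<ominus> x) = y"
    using le_imp_plus_diff[of "y \<ominus> x" y] x y m by (simp add: m' diff_le plus_comm)
  then have mwy: "m \<oplus> w \<preceq> y"
    using plus_left_mono[of w "y \<ominus> x" m] x y m w wy by simp
  have "m \<oplus> w \<preceq> m"
    unfolding m_def using le_diff_diff[of "m \<oplus> w" x y] x y m w mwx mwy by (simp add: m_def)
  then have mw: "m \<oplus> w = m" using m w le_plus[of m w] le_antisym[of m "m \<oplus> w"] by simp
  have "x \<ominus> y \<preceq> \<sim> m"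
    using x y le_plus[of "x \<ominus> y" "\<sim> x"] by (simp add: m_def diff_def[of x "x \<ominus> y"] plus_comm)
  then have "w \<preceq> \<sim> m" using le_trans[of w "x \<ominus> y" "\<sim> m"] wx x y w m by simp
  then show "w = \<zero>" using plus_diff_cancel[of m w] mw m w by simp
qed

text \<open>If \<open>y \<preceq> z\<close>, then \<open>n.y \<preceq> (n - 1).z \<oplus> y \<preceq> n.z = n.y\<close>, so \<open>y\<close> and \<open>z\<close> have the same
  sum with \<open>(n - 1).z\<close>; the side condition on \<open>z\<close> makes both sums untruncated.\<close>

lemma divisor_unique_le:
  assumes y: "y \<in> carrier A" and z: "z \<in> carrier A" and "y \<preceq> z" and n: "n \<ge> 1"
    and eq: "mv_multiple A n y = mv_multiple A n z"
    and zz: "z \<odot> mv_multiple A (n - 1) z = \<zero>"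
  shows "y = z"
proof -
  obtain k where k: "n = Suc k" using n by (cases n) auto
  define a where "a = mv_multiple A k z"
  have a: "a \<in> carrier A" using z by (simp add: a_def)
  have za: "z \<preceq> \<sim> a" using zz z times_eq_zero_iff[OF z a] by (simp add: a_def k)
  have ya: "y \<preceq> \<sim> a" using le_trans[of y z "\<sim> a"] \<open>y \<preceq> z\<close> za y z a by simp
  have "a \<oplus> z \<preceq> a \<oplus> y"
  proof -
    have "mv_multiple A k y \<oplus> y \<preceq> a \<oplus> y"
      using y z a \<open>y \<preceq> z\<close> by (simp add: a_def plus_mono multiple_mono)
    then show ?thesis using eq by (simp add: a_def k)
  qed
  moreover have "a \<oplus> y \<preceq> a \<oplus> z" using y z a \<open>y \<preceq> z\<close> by (simp add: plus_left_mono)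
  ultimately have "a \<oplus> y = a \<oplus> z" using le_antisym[of "a \<oplus> y" "a \<oplus> z"] y z a by simp
  then show ?thesis using plus_diff_cancel[OF a y ya] plus_diff_cancel[OF a z za] by metis
qed

lemma divisor_unique:
  assumes "y \<in> carrier A" "z \<in> carrier A" "y \<preceq> z \<or> z \<preceq> y" "n \<ge> 1"
    and "mv_multiple A n y = mv_multiple A n z"
    and "y \<odot> mv_multiple A (n - 1) y = \<zero>" "z \<odot> mv_multiple A (n - 1) z = \<zero>"
  shows "y = z"
  using assms(3)
proof
  assume "y \<preceq> z"
  then show ?thesis by (rule divisor_unique_le[OF assms(1,2) _ assms(4,5,7)])
next
  assume "z \<preceq> y"
  then show ?thesis by (rule divisor_unique_le[OF assms(2,1) _ assms(4) assms(5)[symmetric] assms(6), symmetric])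
qed


section \<open>Ideals and prime ideals\<close>

definition ideal :: "'a set \<Rightarrow> bool"
  where "ideal P \<longleftrightarrow> P \<subseteq> carrier A \<and> \<zero> \<in> P \<and> (\<forall>x \<in> P. \<forall>y \<in> P. x \<oplus> y \<in> P) \<and>
    (\<forall>x \<in> P. \<forall>y \<in> carrier A. y \<preceq> x \<longrightarrow> y \<in> P)"

text \<open>The improper ideal counts as prime; its quotient is the one-element algebra.\<close>

definition prime_ideal :: "'a set \<Rightarrow> bool"
  where "prime_ideal P \<longleftrightarrow> ideal P \<and> (\<forall>x \<in> carrier A. \<forall>y \<in> carrier A. x \<ominus> y \<in> P \<or> y \<ominus> x \<in> P)"

lemma ideal_subset: "ideal P \<Longrightarrow> x \<in> P \<Longrightarrow> x \<in> carrier A"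
  and ideal_zero: "ideal P \<Longrightarrow> \<zero> \<in> P"
  and ideal_plus: "ideal P \<Longrightarrow> x \<in> P \<Longrightarrow> y \<in> P \<Longrightarrow> x \<oplus> y \<in> P"
  and ideal_down: "ideal P \<Longrightarrow> x \<in> P \<Longrightarrow> y \<in> carrier A \<Longrightarrow> y \<preceq> x \<Longrightarrow> y \<in> P"
  unfolding ideal_def by blast+

text \<open>For an ideal \<open>P\<close> these are the elements whose meet with \<open>v\<close> lies in \<open>P\<close>; quantifying
  over the common lower bounds \<open>w\<close> avoids computing with the meet.\<close>

definition residual :: "'a set \<Rightarrow> 'a \<Rightarrow> 'a set"
  where "residual P v = {x \<in> carrier A. \<forall>w \<in> carrier A. w \<preceq> x \<longrightarrow> w \<preceq> v \<longrightarrow> w \<in> P}"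

text \<open>For closure under sums, split a common lower bound \<open>w\<close> of \<open>x \<oplus> y\<close> and \<open>v\<close> into its part
  \<open>w \<ominus> x\<close>, which is below \<open>y\<close>, and the rest \<open>w \<ominus> (w \<ominus> x)\<close>, which is below \<open>x\<close>.\<close>

lemma ideal_residual:
  assumes P: "ideal P" and v: "v \<in> carrier A"
  shows "ideal (residual P v)"
  unfolding ideal_def
proof (intro conjI ballI impI)
  show "residual P v \<subseteq> carrier A" by (auto simp: residual_def)
  show "\<zero> \<in> residual P v"
    using ideal_zero[OF P] by (auto simp: residual_def le_zero_iff)
next
  fix x y assume xy: "x \<in> residual P v" "y \<in> carrier A" "y \<preceq> x"
  then show "y \<in> residual P v"
    unfolding residual_def using le_trans by blast
next
  fix x y assume x: "x \<in> residual P v" and y: "y \<in> residual P v"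
  have xc: "x \<in> carrier A" and yc: "y \<in> carrier A" using x y by (auto simp: residual_def)
  have "w \<in> P" if w: "w \<in> carrier A" and le: "w \<preceq> x \<oplus> y" and wv: "w \<preceq> v" for w
  proof -
    let ?s = "w \<ominus> x" and ?t = "w \<ominus> (w \<ominus> x)"
    have s: "?s \<preceq> y" "?s \<preceq> w" using diff_le_iff[of w x y] w xc yc le by (simp_all add: diff_le)
    have t: "?t \<preceq> x" "?t \<preceq> w" using w xc by (simp_all add: diff_diff_le diff_le)
    have "?s \<preceq> v" "?t \<preceq> v"
      using s t le_trans[of ?s w v] le_trans[of ?t w v] w xc v wv by simp_all
    then have "?s \<in> P" "?t \<in> P" using s t x y w xc yc by (auto simp: residual_def)
    moreover have "?s \<oplus> ?t = w"
      using le_imp_plus_diff[of ?s w] s w xc by simp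
    ultimately show ?thesis using ideal_plus[OF P] by metis
  qed
  then show "x \<oplus> y \<in> residual P v" using xc yc by (simp add: residual_def)
qed

lemma ideal_subset_residual: "ideal P \<Longrightarrow> P \<subseteq> residual P v"
  unfolding ideal_def residual_def by blast

text \<open>An ideal maximal among those avoiding \<open>c\<close> is meet-prime: if the meet of \<open>u\<close> and \<open>v\<close> is in
  \<open>P\<close> but \<open>u\<close> is not, then \<open>residual P v\<close> is a larger ideal, so it contains \<open>c\<close>.  Hence
  \<open>v\<close> is in \<open>residual P c\<close>; if \<open>v\<close> were not in \<open>P\<close>, this ideal would be larger as well and
  contain \<open>c\<close>, which means \<open>c \<in> P\<close>.\<close>

lemma maximal_avoiding_imp_meet_prime:
  assumes P: "ideal P" "c \<notin> P" and c: "c \<in> carrier A"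
    and max: "\<And>Q. ideal Q \<Longrightarrow> c \<notin> Q \<Longrightarrow> P \<subseteq> Q \<Longrightarrow> Q = P"
    and u: "u \<in> carrier A" and v: "v \<in> carrier A"
    and uv: "\<And>w. w \<in> carrier A \<Longrightarrow> w \<preceq> u \<Longrightarrow> w \<preceq> v \<Longrightarrow> w \<in> P"
  shows "u \<in> P \<or> v \<in> P"
proof (rule ccontr)
  assume "\<not> (u \<in> P \<or> v \<in> P)"
  then have "u \<notin> P" "v \<notin> P" by auto
  have "u \<in> residual P v" using u uv by (simp add: residual_def)
  then have "c \<in> residual P v"
    using \<open>u \<notin> P\<close> max[OF ideal_residual[OF P(1) v]] ideal_subset_residual[OF P(1)] by blast
  then have "v \<in> residual P c" using v by (auto simp: residual_def)
  then have "c \<in> residual P c"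
    using \<open>v \<notin> P\<close> max[OF ideal_residual[OF P(1) c]] ideal_subset_residual[OF P(1)] by blast
  then show False using P(2) c by (auto simp: residual_def)
qed

lemma prime_ideal_avoiding:
  assumes c: "c \<in> carrier A" "c \<noteq> \<zero>"
  obtains P where "prime_ideal P" "c \<notin> P"
proof -
  let ?F = "{P. ideal P \<and> c \<notin> P}"
  have "ideal {\<zero>}" by (auto simp: ideal_def le_zero_iff)
  then have ne: "?F \<noteq> {}" using c by blast
  have "\<exists>M \<in> ?F. \<forall>X \<in> ?F. M \<subseteq> X \<longrightarrow> X = M"
  proof (rule subset_Zorn_nonempty[OF ne])
    fix C assume C: "C \<noteq> {}" "subset.chain ?F C"
    have mem: "\<And>X. X \<in> C \<Longrightarrow> ideal X" "\<And>X. X \<in> C \<Longrightarrow> c \<notin> X"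
      using C by (auto simp: subset.chain_def)
    have "ideal (\<Union>C)"
      unfolding ideal_def
    proof (intro conjI ballI impI)
      show "\<Union>C \<subseteq> carrier A" using mem ideal_subset by blast
      show "\<zero> \<in> \<Union>C" using C mem ideal_zero by blast
    next
      fix x y assume "x \<in> \<Union>C" "y \<in> \<Union>C"
      then obtain X Y where XY: "X \<in> C" "x \<in> X" "Y \<in> C" "y \<in> Y" by blast
      then have "X \<subseteq> Y \<or> Y \<subseteq> X" using C by (auto simp: subset_chain_def)
      then show "x \<oplus> y \<in> \<Union>C" using XY mem(1) ideal_plus by blast
    next
      fix x y assume "x \<in> \<Union>C" "y \<in> carrier A" "y \<preceq> x"
      then show "y \<in> \<Union>C" using mem(1) ideal_down by blast
    qed
    then show "\<Union>C \<in> ?F" using mem(2) by blast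
  qed
  then obtain P where P: "ideal P" "c \<notin> P"
    and max: "\<And>Q. ideal Q \<Longrightarrow> c \<notin> Q \<Longrightarrow> P \<subseteq> Q \<Longrightarrow> Q = P" by blast
  have "x \<ominus> y \<in> P \<or> y \<ominus> x \<in> P" if xy: "x \<in> carrier A" "y \<in> carrier A" for x y
  proof (rule maximal_avoiding_imp_meet_prime[OF P c(1) max])
    fix w assume "w \<in> carrier A" "w \<preceq> x \<ominus> y" "w \<preceq> y \<ominus> x"
    then show "w \<in> P" using prelinearity[OF xy] ideal_zero[OF P(1)] by blast
  qed (use xy in simp_all)
  then have "prime_ideal P" using P(1) by (simp add: prime_ideal_def)
  then show thesis using that P(2) by blast
qed


section \<open>The congruence of an ideal\<close>

definition congr :: "'a set \<Rightarrow> ('a \<times> 'a) set"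
  where "congr P =
    {(x, y). x \<in> carrier A \<and> y \<in> carrier A \<and> x \<ominus> y \<in> P \<and> y \<ominus> x \<in> P}"

lemma diff_triangle:
  assumes "x \<in> carrier A" "y \<in> carrier A" "z \<in> carrier A"
  shows "x \<ominus> z \<preceq> (x \<ominus> y) \<oplus> (y \<ominus> z)"
proof -
  have "x \<preceq> (x \<ominus> y) \<oplus> y" using assms le_plus_diff[of x y] by (simp add: plus_comm)
  moreover have "(x \<ominus> y) \<oplus> y \<preceq> (x \<ominus> y) \<oplus> (z \<oplus> (y \<ominus> z))"
    using assms by (simp add: plus_left_mono le_plus_diff)
  ultimately have "x \<preceq> (x \<ominus> y) \<oplus> (z \<oplus> (y \<ominus> z))"
    by (rule le_trans[rotated 3]) (use assms in simp_all)
  then show ?thesis using assms by (simp add: diff_le_iff plus_ac)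
qed

lemma plus_diff_plus_le:
  assumes "x \<in> carrier A" "y \<in> carrier A" "u \<in> carrier A" "v \<in> carrier A"
  shows "(x \<oplus> u) \<ominus> (y \<oplus> v) \<preceq> (x \<ominus> y) \<oplus> (u \<ominus> v)"
proof -
  have "x \<oplus> u \<preceq> (y \<oplus> (x \<ominus> y)) \<oplus> (v \<oplus> (u \<ominus> v))"
    using assms by (simp add: plus_mono le_plus_diff)
  then show ?thesis using assms by (simp add: diff_le_iff plus_ac)
qed

lemma equiv_congr:
  assumes P: "ideal P"
  shows "equiv (carrier A) (congr P)"
proof (rule equivI)
  show "congr P \<subseteq> carrier A \<times> carrier A" by (auto simp: congr_def)
  show "refl_on (carrier A) (congr P)"
    using ideal_zero[OF P] by (auto simp: refl_on_def congr_def)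
  show "sym (congr P)" by (auto simp: sym_def congr_def)
  show "trans (congr P)"
  proof (rule transI)
    fix x y z assume xyz: "(x, y) \<in> congr P" "(y, z) \<in> congr P"
    then have c: "x \<in> carrier A" "y \<in> carrier A" "z \<in> carrier A" by (auto simp: congr_def)
    have "x \<ominus> z \<in> P" "z \<ominus> x \<in> P"
      using xyz c ideal_down[OF P ideal_plus[OF P] _ diff_triangle[of x y z]]
        ideal_down[OF P ideal_plus[OF P] _ diff_triangle[of z y x]]
      by (simp_all add: congr_def)
    then show "(x, z) \<in> congr P" using c by (simp add: congr_def)
  qed
qed

lemma congr_plus:
  assumes P: "ideal P" and xy: "(x, y) \<in> congr P" and uv: "(u, v) \<in> congr P"
  shows "(x \<oplus> u, y \<oplus> v) \<in> congr P"
proof -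
  have c: "x \<in> carrier A" "y \<in> carrier A" "u \<in> carrier A" "v \<in> carrier A"
    using xy uv by (auto simp: congr_def)
  show ?thesis
    using xy uv c ideal_down[OF P ideal_plus[OF P] _ plus_diff_plus_le[of x y u v]]
      ideal_down[OF P ideal_plus[OF P] _ plus_diff_plus_le[of y x v u]]
    by (simp add: congr_def)
qed

lemma congr_neg: "(x, y) \<in> congr P \<Longrightarrow> (\<sim> x, \<sim> y) \<in> congr P"
  by (auto simp: congr_def neg_diff_neg)

lemma congr_one_iff:
  assumes "ideal P" "x \<in> carrier A" "y \<in> carrier A"
  shows "(\<sim> x \<oplus> y, \<one>) \<in> congr P \<longleftrightarrow> x \<ominus> y \<in> P"
  using assms ideal_zero[of P] by (simp add: congr_def diff_def)

end


section \<open>Quotients of DMV-algebras\<close>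

context dmv_algebra
begin

definition quot :: "'a set \<Rightarrow> 'a set dmv_struct"
  where "quot P = \<lparr>
    carrier = carrier A // congr P,
    mv_plus = (\<lambda>X Y. \<Union>x \<in> X. \<Union>y \<in> Y. congr P `` {x \<oplus> y}),
    mv_neg = (\<lambda>X. \<Union>x \<in> X. congr P `` {\<sim> x}),
    mv_zero = congr P `` {\<zero>},
    mv_one = congr P `` {\<one>},
    dmv_delta = (\<lambda>n X. \<Union>x \<in> X. congr P `` {\<delta> n x})\<rparr>"

context
  fixes P assumes P: "ideal P"
begin

abbreviation cls where "cls x \<equiv> congr P `` {x}"

lemma carrier_quot: "carrier (quot P) = cls ` carrier A"
  by (auto simp: quot_def quotient_def)

lemma cls_in_quot [simp]: "x \<in> carrier A \<Longrightarrow> cls x \<in> carrier (quot P)"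
  by (simp add: carrier_quot)

lemma cls_eq_iff: "x \<in> carrier A \<Longrightarrow> y \<in> carrier A \<Longrightarrow> cls x = cls y \<longleftrightarrow> (x, y) \<in> congr P"
  using eq_equiv_class_iff[OF equiv_congr[OF P]] .

lemma cls_plus [simp]:
  assumes "x \<in> carrier A" "y \<in> carrier A"
  shows "cls x \<oplus>\<^bsub>quot P\<^esub> cls y = cls (x \<oplus> y)"
proof -
  have "congruent2 (congr P) (congr P) (\<lambda>x y. cls (x \<oplus> y))"
    using congr_plus[OF P] equiv_class_eq[OF equiv_congr[OF P]]
    by (intro congruent2I') blast
  then show ?thesis
    using UN_equiv_class2[OF equiv_congr[OF P] equiv_congr[OF P]] assms by (simp add: quot_def)
qed

lemma cls_neg [simp]:
  assumes "x \<in> carrier A"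
  shows "\<sim>\<^bsub>quot P\<^esub> (cls x) = cls (\<sim> x)"
proof -
  have "congruent (congr P) (\<lambda>x. cls (\<sim> x))"
    using congr_neg equiv_class_eq[OF equiv_congr[OF P]] by (intro congruentI) blast
  then show ?thesis
    using UN_equiv_class[OF equiv_congr[OF P]] assms by (simp add: quot_def)
qed

lemma quot_zero [simp]: "\<zero>\<^bsub>quot P\<^esub> = cls \<zero>" and quot_one [simp]: "\<one>\<^bsub>quot P\<^esub> = cls \<one>"
  by (simp_all add: quot_def)

lemma mv_algebra_quot: "mv_algebra (quot P)"
proof
  fix X Y assume "X \<in> carrier (quot P)" "Y \<in> carrier (quot P)"
  then obtain x y where xy: "x \<in> carrier A" "y \<in> carrier A" "X = cls x" "Y = cls y"
    by (auto simp: carrier_quot)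
  show "X \<oplus>\<^bsub>quot P\<^esub> Y = Y \<oplus>\<^bsub>quot P\<^esub> X"
    using xy plus_comm[of x y] by simp
  show "\<sim>\<^bsub>quot P\<^esub> (\<sim>\<^bsub>quot P\<^esub> X \<oplus>\<^bsub>quot P\<^esub> Y) \<oplus>\<^bsub>quot P\<^esub> Y =
      \<sim>\<^bsub>quot P\<^esub> (\<sim>\<^bsub>quot P\<^esub> Y \<oplus>\<^bsub>quot P\<^esub> X) \<oplus>\<^bsub>quot P\<^esub> X"
    using xy lukasiewicz[of x y] by simp
qed (auto simp: carrier_quot plus_assoc)

lemma cls_multiple:
  "x \<in> carrier A \<Longrightarrow> mv_multiple (quot P) n (cls x) = cls (mv_multiple A n x)"
  by (induction n) simp_all

lemma cls_times:
  "x \<in> carrier A \<Longrightarrow> y \<in> carrier A \<Longrightarrow> cls x \<odot>\<^bsub>quot P\<^esub> cls y = cls (x \<odot> y)"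
  by (simp add: mv_times_def)

lemma quot_le_iff:
  "x \<in> carrier A \<Longrightarrow> y \<in> carrier A \<Longrightarrow> mv_le (quot P) (cls x) (cls y) \<longleftrightarrow> x \<ominus> y \<in> P"
  using congr_one_iff[OF P, of x y] by (simp add: mv_le_def cls_eq_iff)

lemma cls_delta_D1:
  "n \<ge> 1 \<Longrightarrow> x \<in> carrier A \<Longrightarrow> mv_multiple (quot P) n (cls (\<delta> n x)) = cls x"
  by (simp add: cls_multiple delta_closed D1)

lemma cls_delta_D2:
  "n \<ge> 1 \<Longrightarrow> x \<in> carrier A \<Longrightarrow>
    cls (\<delta> n x) \<odot>\<^bsub>quot P\<^esub> mv_multiple (quot P) (n - 1) (cls (\<delta> n x)) = \<zero>\<^bsub>quot P\<^esub>"
  using D2[of n x] by (simp add: cls_multiple cls_times delta_closed)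

end

context
  fixes P assumes P: "prime_ideal P"
begin

lemma prime_ideal_ideal: "ideal P"
  using P by (simp add: prime_ideal_def)

lemma quot_total:
  assumes "X \<in> carrier (quot P)" "Y \<in> carrier (quot P)"
  shows "mv_le (quot P) X Y \<or> mv_le (quot P) Y X"
proof -
  note I = prime_ideal_ideal
  obtain x y where "x \<in> carrier A" "y \<in> carrier A" "X = cls P x" "Y = cls P y"
    using assms by (auto simp: carrier_quot[OF I])
  then show ?thesis using P by (simp add: quot_le_iff[OF I] prime_ideal_def)
qed

text \<open>Both classes are untruncated \<open>n\<close>-th parts of the same element of a totally ordered algebra.\<close>

lemma cls_delta_cong:
  assumes n: "n \<ge> 1" and xy: "(x, y) \<in> congr P"
  shows "cls P (\<delta> n x) = cls P (\<delta> n y)"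
proof -
  note I = prime_ideal_ideal
  have c: "x \<in> carrier A" "y \<in> carrier A" using xy by (auto simp: congr_def)
  interpret Q: mv_algebra "quot P" by (rule mv_algebra_quot[OF I])
  have cls: "cls P (\<delta> n x) \<in> carrier (quot P)" "cls P (\<delta> n y) \<in> carrier (quot P)"
    using n c by (simp_all add: cls_in_quot[OF I] delta_closed)
  have "cls P x = cls P y" using xy c by (simp add: cls_eq_iff[OF I])
  then have "mv_multiple (quot P) n (cls P (\<delta> n x)) = mv_multiple (quot P) n (cls P (\<delta> n y))"
    by (simp only: cls_delta_D1[OF I n c(1)] cls_delta_D1[OF I n c(2)])
  then show ?thesis
    using Q.divisor_unique[OF cls quot_total[OF cls] n]
      cls_delta_D2[OF I n c(1)] cls_delta_D2[OF I n c(2)] by blast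
qed

lemma cls_delta:
  assumes "n \<ge> 1" "x \<in> carrier A"
  shows "\<delta>\<^bsub>quot P\<^esub> n (cls P x) = cls P (\<delta> n x)"
proof -
  have "congruent (congr P) (\<lambda>x. cls P (\<delta> n x))"
    using cls_delta_cong[OF assms(1)] by (rule congruentI)
  then show ?thesis
    using UN_equiv_class[OF equiv_congr[OF prime_ideal_ideal]] assms by (simp add: quot_def)
qed

lemma linear_dmv_algebra_quot: "linear_dmv_algebra (quot P)"
proof -
  note I = prime_ideal_ideal
  interpret Q: mv_algebra "quot P" by (rule mv_algebra_quot[OF I])
  show ?thesis
  proof
    fix n :: nat and X assume n: "n \<ge> 1" and "X \<in> carrier (quot P)"
    then obtain x where x: "X = cls P x" "x \<in> carrier A" by (auto simp: carrier_quot[OF I])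
    show "\<delta>\<^bsub>quot P\<^esub> n X \<in> carrier (quot P)"
      using n x by (simp add: cls_delta cls_in_quot[OF I] delta_closed)
    show "mv_multiple (quot P) n (\<delta>\<^bsub>quot P\<^esub> n X) = X"
      using n x by (simp add: cls_delta cls_delta_D1[OF I])
    show "\<delta>\<^bsub>quot P\<^esub> n X \<odot>\<^bsub>quot P\<^esub> mv_multiple (quot P) (n - 1) (\<delta>\<^bsub>quot P\<^esub> n X) = \<zero>\<^bsub>quot P\<^esub>"
      using n x cls_delta_D2[OF I, of n x] by (simp add: cls_delta)
  qed (rule quot_total)
qed

end

end


section \<open>Subdirect products from separating families\<close>

text \<open>The embedding sends \<open>x\<close> to the family of all \<open>f i x\<close>, and its image is the required
  subalgebra.\<close>

lemma subdirect_productI: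
  assumes hom: "\<And>i. i \<in> I \<Longrightarrow> f i \<in> dmv_hom A (B i)"
    and onto: "\<And>i. i \<in> I \<Longrightarrow> f i ` carrier A = carrier (B i)"
    and sep: "\<And>x y. x \<in> carrier A \<Longrightarrow> y \<in> carrier A \<Longrightarrow> x \<noteq> y \<Longrightarrow> \<exists>i \<in> I. f i x \<noteq> f i y"
    and A: "dmv_algebra A"
  shows "dmv_subdirect_product A I B"
proof -
  interpret dmv_algebra A by (rule A)
  define h where "h x = (\<lambda>i \<in> I. f i x)" for x
  let ?S = "h ` carrier A" and ?\<Pi> = "dmv_product I B"
  have h_plus: "h (x \<oplus>\<^bsub>A\<^esub> y) = h x \<oplus>\<^bsub>?\<Pi>\<^esub> h y" if "x \<in> carrier A" "y \<in> carrier A" for x y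
    using that hom by (auto simp: h_def dmv_product_def dmv_hom_def)
  have h_neg: "h (\<sim>\<^bsub>A\<^esub> x) = \<sim>\<^bsub>?\<Pi>\<^esub> (h x)" if "x \<in> carrier A" for x
    using that hom by (auto simp: h_def dmv_product_def dmv_hom_def)
  have h_zero: "h \<zero>\<^bsub>A\<^esub> = \<zero>\<^bsub>?\<Pi>\<^esub>" and h_one: "h \<one>\<^bsub>A\<^esub> = \<one>\<^bsub>?\<Pi>\<^esub>"
    using hom by (auto simp: h_def dmv_product_def dmv_hom_def)
  have h_delta: "h (\<delta>\<^bsub>A\<^esub> n x) = \<delta>\<^bsub>?\<Pi>\<^esub> n (h x)" if "n \<ge> 1" "x \<in> carrier A" for n x
    using that hom by (auto simp: h_def dmv_product_def dmv_hom_def)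
  have "f i x \<in> carrier (B i)" if "i \<in> I" "x \<in> carrier A" for i x
    using hom[OF that(1)] that(2) by (auto simp: dmv_hom_def)
  then have S: "?S \<subseteq> carrier ?\<Pi>"
    by (auto simp: h_def dmv_product_def)
  have "dmv_subalgebra ?S ?\<Pi>"
    unfolding dmv_subalgebra_def
  proof (intro conjI allI impI ballI S)
    fix X Y assume "X \<in> ?S" "Y \<in> ?S"
    then show "X \<oplus>\<^bsub>?\<Pi>\<^esub> Y \<in> ?S" by (auto simp: h_plus[symmetric])
  next
    fix X assume "X \<in> ?S"
    then show "\<sim>\<^bsub>?\<Pi>\<^esub> X \<in> ?S" by (auto simp: h_neg[symmetric])
  next
    show "\<zero>\<^bsub>?\<Pi>\<^esub> \<in> ?S" "\<one>\<^bsub>?\<Pi>\<^esub> \<in> ?S" by (auto simp: h_zero[symmetric] h_one[symmetric])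
  next
    fix n :: nat and X assume "1 \<le> n" "X \<in> ?S"
    then show "\<delta>\<^bsub>?\<Pi>\<^esub> n X \<in> ?S" by (auto simp: h_delta[symmetric] delta_closed)
  qed
  moreover have "(\<lambda>g. g i) ` ?S = carrier (B i)" if "i \<in> I" for i
    using onto[OF that] that by (simp add: image_image h_def)
  moreover have "h \<in> dmv_iso A (?\<Pi>\<lparr>carrier := ?S\<rparr>)"
  proof -
    have "inj_on h (carrier A)"
    proof (rule inj_onI, rule ccontr)
      fix x y assume xy: "x \<in> carrier A" "y \<in> carrier A" "h x = h y" "x \<noteq> y"
      then obtain i where "i \<in> I" "f i x \<noteq> f i y" using sep by blast
      then show False using fun_cong[OF xy(3), of i] by (simp add: h_def)
    qed
    then show ?thesis
      by (auto simp: dmv_iso_def dmv_hom_def bij_betw_def h_plus h_neg h_zero h_one h_delta)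
  qed
  ultimately show ?thesis unfolding dmv_subdirect_product_def by blast
qed

theorem theorem3p9:
  fixes A :: "'a dmv_struct"
  assumes "dmv_algebra A"
  shows "\<exists>(I :: 'a set set) (B :: 'a set \<Rightarrow> 'a set dmv_struct).
    (\<forall>i \<in> I. linear_dmv_algebra (B i)) \<and> dmv_subdirect_product A I B"
proof -
  interpret dmv_algebra A by (rule assms)
  let ?I = "{P. prime_ideal P}"
  have "dmv_subdirect_product A ?I quot"
  proof (rule subdirect_productI)
    fix P assume "P \<in> ?I"
    then have P: "prime_ideal P" and I: "ideal P" by (simp_all add: prime_ideal_ideal)
    show "(\<lambda>x. congr P `` {x}) \<in> dmv_hom A (quot P)"
      using cls_delta[OF P]
      by (auto simp: dmv_hom_def cls_in_quot[OF I] cls_plus[OF I] cls_neg[OF I]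
          quot_zero[OF I] quot_one[OF I])
    show "(\<lambda>x. congr P `` {x}) ` carrier A = carrier (quot P)"
      by (simp add: carrier_quot[OF I])
  next
    fix x y assume xy: "x \<in> carrier A" "y \<in> carrier A" "x \<noteq> y"
    then have "x \<ominus> y \<noteq> \<zero>\<^bsub>A\<^esub> \<or> y \<ominus> x \<noteq> \<zero>\<^bsub>A\<^esub>"
      using le_antisym[of x y] by (auto simp: diff_eq_zero_iff)
    then obtain P where P: "prime_ideal P" "x \<ominus> y \<notin> P \<or> y \<ominus> x \<notin> P"
      using prime_ideal_avoiding xy diff_closed by metis
    then have "(x, y) \<notin> congr P" by (auto simp: congr_def)
    then show "\<exists>P \<in> ?I. congr P `` {x} \<noteq> congr P `` {y}"
      using P(1) xy cls_eq_iff[OF prime_ideal_ideal[OF P(1)]] by blast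
  qed (rule assms)
  then show ?thesis using linear_dmv_algebra_quot by blast
qed

end
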